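(* Let $q$ be a prime power and let $d,n,s$ be positive integers with $\gcd(s,n)=1$ and $d\geq 3$. Let $\sigma$ be the automorphism $x\mapsto x^{q^s}$ of $\mathbb{F}_{q^n}$, and for $a,b\in\mathbb{F}_{q^n}$ consider the $\mathbb{F}_q$-linear map $L_{a,b}\colon \mathbb{F}_{q^n}\to\mathbb{F}_{q^n}$, $x\mapsto ax+bx^{\sigma}-x^{\sigma^d}$. \begin{enumerate} \item[(a)] If $n\leq d(d-1)$ and $d\nmid n$, then $\dim_{\mathbb{F}_q}(\ker L_{a,b})<d$ for all $a,b\in\mathbb{F}_{q^n}$. \item[(b)] If $n\leq d(d-1)$ and $d\mid n$, then for $a,b\in\mathbb{F}_{q^n}$ we have $\dim_{\mathbb{F}_q}(\ker L_{a,b})=d$ if and only if $b=0$ and $\mathrm{N}_{q^n/q^d}(a)=1$. \item[(c)] If $n=d(d-1)+1$, then for $a,b\in\mathbb{F}_{q^n}$ we have $\dim_{\mathbb{F}_q}(\ker L_{a,b})=d$ if and only if $\mathrm{N}_{q^n/q}(a)=(-1)^{d-1}$, $b=-a^{\sigma f_1}$ where $f_1=\sum_{i=0}^{d-1}\sigma^{id}$, and $d-1$ is a power of the characteristic $p$ of $\mathbb{F}_q$. \end{enumerate}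
   Context: $\mathrm{N}_{q^n/q^m}$ denotes the field norm from $\mathbb{F}_{q^n}$ to $\mathbb{F}_{q^m}$. Exponent notation: for $a\in\mathbb{F}_{q^n}$ and nonnegative integers $e_i$, $a^{\sum_i e_i\sigma^{i}}$ means $\prod_i (\sigma^{i}(a))^{e_i}$; thus $a^{\sigma f_1}=\prod_{i=0}^{d-1}\sigma^{id+1}(a)$. *)

theory Defs
  imports "HOL-Library.Cardinality" "HOL-Number_Theory.Number_Theory"
begin

text \<open>
  Throughout, a finite type \<open>'a\<close> of class \<open>field\<close> with \<open>CARD('a) = q ^ n\<close> is the field with
  \<open>q ^ n\<close> elements, and the field with \<open>q\<close> elements is a finite field type \<open>'k\<close>
  with \<open>CARD('k) = q\<close> together with an embedding into \<open>'a\<close>. Since \<open>'k\<close> is a field,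
  preservation of 0 and injectivity follow from the clauses below.
\<close>

definition field_embedding :: "('k::field \<Rightarrow> 'a::field) \<Rightarrow> bool" where
  "field_embedding \<iota> \<longleftrightarrow>
     \<iota> 1 = 1 \<and> (\<forall>x y. \<iota> (x + y) = \<iota> x + \<iota> y) \<and> (\<forall>x y. \<iota> (x * y) = \<iota> x * \<iota> y)"

definition subspace_dim :: "('k::field \<Rightarrow> 'a::field) \<Rightarrow> 'a set \<Rightarrow> nat" where
  "subspace_dim \<iota> V = vector_space.dim (\<lambda>c x. \<iota> c * x) V"

text \<open>
  If \<open>'a\<close> has \<open>q ^ n\<close> elements and \<open>m\<close> divides \<open>n\<close>, then \<open>subfield_of_order (q ^ m)\<close> is the
  unique subfield of \<open>'a\<close> with \<open>q ^ m\<close> elements.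
\<close>

definition subfield_of_order :: "nat \<Rightarrow> 'a::field set" where
  "subfield_of_order r = {x. x ^ r = x}"

definition galois_group :: "'a::field set \<Rightarrow> ('a \<Rightarrow> 'a) set" where
  "galois_group K = {\<phi>. bij \<phi> \<and> field_embedding \<phi> \<and> (\<forall>x\<in>K. \<phi> x = x)}"

text \<open>
  Extensions of finite fields are Galois, so the norm is the product of the conjugates.
\<close>

definition field_norm :: "'a::{field,finite} set \<Rightarrow> 'a \<Rightarrow> 'a" where
  "field_norm K a = (\<Prod>\<phi>\<in>galois_group K. \<phi> a)"

definition frob :: "nat \<Rightarrow> nat \<Rightarrow> 'a::field \<Rightarrow> 'a" where
  "frob q s x = x ^ (q ^ s)"

definition L_map :: "('a::field \<Rightarrow> 'a) \<Rightarrow> nat \<Rightarrow> 'a \<Rightarrow> 'a \<Rightarrow> 'a \<Rightarrow> 'a" where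
  "L_map \<sigma> d a b x = a * x + b * \<sigma> x - (\<sigma> ^^ d) x"

definition ker :: "('a \<Rightarrow> 'b::zero) \<Rightarrow> 'a set" where
  "ker f = {x. f x = 0}"

text \<open>
  \<open>a\<close> raised to the formal exponent \<open>\<sigma> f\<^sub>1\<close>, where \<open>f\<^sub>1\<close> is the sum of \<open>\<sigma> ^^ (i * d)\<close> over \<open>i < d\<close>:
  sums of powers of \<open>\<sigma>\<close> in the exponent stand for products of images.
\<close>

definition pow_sigma_f1 :: "('a::field \<Rightarrow> 'a) \<Rightarrow> nat \<Rightarrow> 'a \<Rightarrow> 'a" where
  "pow_sigma_f1 \<sigma> d a = (\<Prod>i<d. (\<sigma> ^^ (i * d + 1)) a)"

end

theory Submission
  imports Defs "HOL-Algebra.Exponent" "HOL-Computational_Algebra.Polynomial"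
begin

text \<open>
  On the kernel of \<open>L\<close> the sequence \<open>z k = (\<sigma> ^^ k) x\<close> satisfies
  \<open>z (k + d) = \<sigma>\<^sup>k(a) z k + \<sigma>\<^sup>k(b) z (k + 1)\<close>. A nonzero \<open>\<sigma>\<close>-polynomial of \<open>\<sigma>\<close>-degree
  \<open>k\<close> has at most \<open>q ^ k\<close> roots, so the kernel has dimension \<open>d\<close> if and only if \<open>L\<close> is a
  right factor of \<open>\<sigma> ^^ n - id\<close>, that is, if and only if every solution of the recurrence, with
  arbitrary initial values, satisfies \<open>z n = z 0\<close>. The coefficient of \<open>z j\<close> in \<open>z n\<close> is the
  weighted number of descents from \<open>n\<close> to \<open>j\<close> by steps \<open>d\<close> and \<open>d - 1\<close>. For
  \<open>n \<le> d * (d - 1)\<close> a suitable coefficient comes from a single descent, consisting of equal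
  steps; being a product of conjugates of \<open>a\<close> or of \<open>b\<close>, it decides the case. For
  \<open>n = d * (d - 1) + 1\<close> the coefficients of \<open>z 0\<close> and \<open>z 1\<close> determine \<open>b\<close> and the norm of
  \<open>a\<close>; for this \<open>b\<close> all descents with \<open>v\<close> steps \<open>d - 1\<close> have the same weight, so the
  remaining coefficients are nonzero multiples of \<open>(d - 1) choose v\<close>, and these all vanish in
  characteristic \<open>p\<close> exactly if \<open>d - 1\<close> is a power of \<open>p\<close>.
\<close>

section \<open>Roots of \<open>\<sigma>\<close>-polynomials\<close>

text \<open>Every nonempty fibre of \<open>f\<close> is a translate of its kernel. With
  \<open>Z\<close> the kernel of a second additive map, this bounds the kernel of a composition by
  the product of the two kernel sizes.\<close>

lemma card_additive_preimage_le:
  fixes f :: "'a::{ab_group_add,finite} \<Rightarrow> 'b::ab_group_add"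
  assumes add: "\<And>x y. f (x + y) = f x + f y" and "finite Z"
  shows "card {x. f x \<in> Z} \<le> card Z * card {x. f x = 0}"
proof -
  interpret additive f by standard (rule add)
  have fibre: "card {x. f x = z} \<le> card {x. f x = 0}" for z
  proof (cases "\<exists>x. f x = z")
    case True
    then obtain x0 where "f x0 = z" ..
    then show ?thesis
      by (intro card_inj_on_le[of "\<lambda>x. x - x0"]) (auto simp: inj_on_def diff)
  qed simp
  have "{x. f x \<in> Z} = (\<Union>z\<in>Z. {x. f x = z})" by blast
  then have "card {x. f x \<in> Z} \<le> (\<Sum>z\<in>Z. card {x. f x = z})"
    using card_UN_le[OF \<open>finite Z\<close>] by metis
  also have "\<dots> \<le> (\<Sum>z\<in>Z. card {x. f x = 0})" by (intro sum_mono fibre)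
  finally show ?thesis by simp
qed

text \<open>Abel summation with tail sums as new coefficients: when the \<open>p i\<close> add up to
  0, only the differences of \<open>y\<close> survive.\<close>

lemma sum_by_parts:
  fixes p y :: "nat \<Rightarrow> 'a::comm_ring_1"
  shows "(\<Sum>i\<le>k. p i * y i) =
    (\<Sum>i\<le>k. p i) * y 0 + (\<Sum>j<k. (\<Sum>i=Suc j..k. p i) * (y (Suc j) - y j))"
proof (induction k)
  case (Suc k)
  have "(\<Sum>j<Suc k. (\<Sum>i=Suc j..Suc k. p i) * (y (Suc j) - y j)) =
      (\<Sum>j<Suc k. (\<Sum>i=Suc j..k. p i) * (y (Suc j) - y j) + p (Suc k) * (y (Suc j) - y j))"
    by (intro sum.cong) (auto simp: algebra_simps)
  also have "\<dots> = (\<Sum>j<k. (\<Sum>i=Suc j..k. p i) * (y (Suc j) - y j))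
      + p (Suc k) * (y (Suc k) - y 0)"
    by (simp add: sum.distrib flip: sum_distrib_left sum_lessThan_telescope)
  finally show ?case using Suc by (simp add: algebra_simps)
qed simp

locale field_endomorphism =
  fixes \<sigma> :: "'a::field \<Rightarrow> 'a"
  assumes \<sigma>_add: "\<sigma> (x + y) = \<sigma> x + \<sigma> y"
    and \<sigma>_mult: "\<sigma> (x * y) = \<sigma> x * \<sigma> y"
    and \<sigma>_one: "\<sigma> 1 = 1"
begin

lemma iter_add: "(\<sigma> ^^ i) (x + y) = (\<sigma> ^^ i) x + (\<sigma> ^^ i) y"
  by (induction i) (simp_all add: \<sigma>_add)

lemma iter_mult: "(\<sigma> ^^ i) (x * y) = (\<sigma> ^^ i) x * (\<sigma> ^^ i) y"
  by (induction i) (simp_all add: \<sigma>_mult)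

lemma iter_one: "(\<sigma> ^^ i) 1 = 1"
  by (induction i) (simp_all add: \<sigma>_one)

sublocale additive "\<sigma> ^^ i" for i
  by standard (rule iter_add)

lemma iter_eq_0_iff: "(\<sigma> ^^ i) x = 0 \<longleftrightarrow> x = 0"
proof
  assume "(\<sigma> ^^ i) x = 0"
  then have "x \<noteq> 0 \<Longrightarrow> (\<sigma> ^^ i) (x * inverse x) = 0" by (simp only: iter_mult) simp
  then show "x = 0" by (auto simp: iter_one)
qed (simp add: zero)

lemma \<sigma>_zero: "\<sigma> 0 = 0"
  using zero[of 1] by simp

end

text \<open>The fixed points form the kernel of the linear factor \<sigma> - id, so \<open>q\<close>
  is the factor by which each further \<sigma>-degree can enlarge a set of roots.\<close>

locale finite_fixed_field = field_endomorphism \<sigma>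
  for \<sigma> :: "'a::{field,finite} \<Rightarrow> 'a" +
  fixes q :: nat
  assumes card_fixed_le: "card {x. \<sigma> x = x} \<le> q"
begin

lemma q_pos: "q > 0"
proof -
  have "card {x. \<sigma> x = x} > 0" by (auto simp: card_gt_0_iff intro: exI[of _ 1] \<sigma>_one)
  then show ?thesis using card_fixed_le by simp
qed

text \<open>Dividing by a root \<open>u\<close> turns the polynomial into one that kills 1; summation by parts
  then splits off the right factor \<open>\<sigma> - id\<close>.\<close>

lemma card_roots_le_degree:
  assumes "p k \<noteq> 0"
  shows "card {x. (\<Sum>i\<le>k. p i * (\<sigma> ^^ i) x) = 0} \<le> q ^ k"
  using assms
proof (induction k arbitrary: p)
  case 0
  then show ?case by simp
next
  case (Suc k)
  let ?V = "{x. (\<Sum>i\<le>Suc k. p i * (\<sigma> ^^ i) x) = 0}"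
  show ?case
  proof (cases "?V \<subseteq> {0}")
    case True
    then have "card ?V \<le> 1" using card_mono[of "{0}" ?V] by simp
    also have "1 \<le> q ^ Suc k" using q_pos by (simp add: Suc_le_eq)
    finally show ?thesis .
  next
    case False
    then obtain u where u: "u \<noteq> 0" "(\<Sum>i\<le>Suc k. p i * (\<sigma> ^^ i) u) = 0" by blast
    define p' where "p' i = p i * (\<sigma> ^^ i) u" for i
    define r where "r j = (\<Sum>i=Suc j..Suc k. p' i)" for j
    \<comment> \<open>The tail sum \<open>r k\<close> consists of the single term
      \<open>p' (Suc k)\<close>, so the quotient has \<sigma>-degree exactly
      \<open>k\<close>.\<close>
    have "r k \<noteq> 0"
      using Suc.prems u(1) by (simp add: r_def p'_def iter_eq_0_iff del: funpow.simps)
    note IH = Suc.IH[of r, OF this]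
    have factor: "(\<Sum>i\<le>Suc k. p i * (\<sigma> ^^ i) (u * y)) = (\<Sum>j\<le>k. r j * (\<sigma> ^^ j) (\<sigma> y - y))"
      for y
    proof -
      have "(\<Sum>i\<le>Suc k. p i * (\<sigma> ^^ i) (u * y)) = (\<Sum>i\<le>Suc k. p' i * (\<sigma> ^^ i) y)"
        by (simp only: p'_def iter_mult mult.assoc)
      also have "\<dots> = (\<Sum>j<Suc k. r j * ((\<sigma> ^^ Suc j) y - (\<sigma> ^^ j) y))"
        using u(2) unfolding sum_by_parts[of p'] r_def by (simp only: p'_def[symmetric]) simp
      also have "\<dots> = (\<Sum>j<Suc k. r j * (\<sigma> ^^ j) (\<sigma> y - y))"
        by (simp only: diff funpow_Suc_right o_apply)
      finally show ?thesis by (simp only: lessThan_Suc_atMost)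
    qed
    let ?Z = "{z. (\<Sum>j\<le>k. r j * (\<sigma> ^^ j) z) = 0}"
    have "card ?V \<le> card {y. \<sigma> y - y \<in> ?Z}"
    proof (rule card_inj_on_le[of "\<lambda>x. x / u"])
      show "(\<lambda>x. x / u) ` ?V \<subseteq> {y. \<sigma> y - y \<in> ?Z}"
      proof clarify
        fix x assume "(\<Sum>i\<le>Suc k. p i * (\<sigma> ^^ i) x) = 0"
        then show "(\<Sum>j\<le>k. r j * (\<sigma> ^^ j) (\<sigma> (x / u) - x / u)) = 0"
          using factor[of "x / u"] u(1) by simp
      qed
    qed (use u(1) in \<open>auto simp: inj_on_def\<close>)
    also have "\<dots> \<le> card ?Z * card {y. \<sigma> y - y = 0}"
      by (rule card_additive_preimage_le) (auto simp: \<sigma>_add)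
    also have "\<dots> \<le> q ^ k * q"
      using IH card_fixed_le by (intro mult_mono) auto
    finally show ?thesis by (simp add: mult.commute)
  qed
qed

lemma card_roots_le:
  assumes "p m \<noteq> 0" and "m < N" and "\<And>i. m < i \<Longrightarrow> i < N \<Longrightarrow> p i = 0"
  shows "card {x. (\<Sum>i<N. p i * (\<sigma> ^^ i) x) = 0} \<le> q ^ m"
proof -
  have "(\<Sum>i<N. p i * (\<sigma> ^^ i) x) = (\<Sum>i\<le>m. p i * (\<sigma> ^^ i) x)" for x
    using assms(2,3) by (intro sum.mono_neutral_right) auto
  then show ?thesis using card_roots_le_degree[of p m, OF assms(1)] by simp
qed

text \<open>The largest index \<open>m < N\<close> with nonzero coefficient would leave at most
  \<open>q ^ m < q ^ N\<close> roots.\<close>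

lemma coeffs_eq_0_if_card_roots:
  assumes "card {x. (\<Sum>i<N. p i * (\<sigma> ^^ i) x) = 0} \<ge> q ^ N" and "i < N" and "q > 1"
  shows "p i = 0"
proof (rule ccontr)
  assume "p i \<noteq> 0"
  define m where "m = Max {i. i < N \<and> p i \<noteq> 0}"
  have *: "{i. i < N \<and> p i \<noteq> 0} \<noteq> {}" "finite {i. i < N \<and> p i \<noteq> 0}"
    using \<open>p i \<noteq> 0\<close> \<open>i < N\<close> by auto
  have m: "m < N" "p m \<noteq> 0" using Max_in[OF *(2,1)] unfolding m_def by auto
  have "p j = 0" if "m < j" "j < N" for j
    using Max_ge[OF *(2), of j] that unfolding m_def[symmetric] by auto
  then have "card {x. (\<Sum>i<N. p i * (\<sigma> ^^ i) x) = 0} \<le> q ^ m"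
    using m by (intro card_roots_le)
  moreover have "q ^ m < q ^ N" using m(1) \<open>q > 1\<close> by (simp add: power_strict_increasing)
  ultimately show False using assms(1) by simp
qed

end

section \<open>The recurrence on the kernel\<close>

text \<open>For \<open>d < 2\<close> the index \<open>Suc (k - d)\<close> need not be smaller than
  \<open>k\<close>; the guard ends the recursion there. The sequences \<open>A\<close> and
  \<open>B\<close> will be the conjugates of \<open>a\<close> and \<open>b\<close>.\<close>

function linrec ::
    "nat \<Rightarrow> (nat \<Rightarrow> 'a) \<Rightarrow> (nat \<Rightarrow> 'a) \<Rightarrow> (nat \<Rightarrow> 'a) \<Rightarrow> nat \<Rightarrow> 'a::comm_ring_1" where
  "linrec d A B w k = (if k < d \<or> d < 2 then w k
     else A (k - d) * linrec d A B w (k - d) + B (k - d) * linrec d A B w (Suc (k - d)))"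
  by auto
termination by (relation "measure (\<lambda>(d, A, B, w, k). k)") auto

declare linrec.simps [simp del]

lemma linrec_init: "k < d \<Longrightarrow> linrec d A B w k = w k"
  by (simp add: linrec.simps)

lemma linrec_step:
  "d \<ge> 2 \<Longrightarrow> linrec d A B w (k + d) = A k * linrec d A B w k + B k * linrec d A B w (Suc k)"
  by (subst linrec.simps) simp

lemma linrec_unique:
  assumes "d \<ge> 2" and "\<And>k. k < d \<Longrightarrow> z k = w k"
    and "\<And>k. z (k + d) = A k * z k + B k * z (Suc k)"
  shows "z k = linrec d A B w k"
proof (induction k rule: less_induct)
  case (less k)
  show ?case
  proof (cases "k < d")
    case False
    then obtain l where "k = l + d" by (metis le_Suc_ex linorder_not_less add.commute)
    then show ?thesis using less[of l] less[of "Suc l"] assms by (simp add: linrec_step)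
  qed (simp add: assms linrec_init)
qed

text \<open>Superposition: the right-hand side solves the same recurrence with the same initial
  values. Unit initial values therefore read off single coefficients.\<close>

lemma linrec_linear:
  assumes "d \<ge> 2"
  shows "linrec d A B w k = (\<Sum>j<d. linrec d A B (\<lambda>i. of_bool (i = j)) k * w j)"
proof (rule linrec_unique[OF assms, symmetric])
  fix k assume "k < d"
  then show "(\<Sum>j<d. linrec d A B (\<lambda>i. of_bool (i = j)) k * w j) = w k"
    by (simp add: linrec_init of_bool_def if_distrib[of "\<lambda>x. x * _"] cong: if_cong)
next
  fix k
  show "(\<Sum>j<d. linrec d A B (\<lambda>i. of_bool (i = j)) (k + d) * w j) =
      A k * (\<Sum>j<d. linrec d A B (\<lambda>i. of_bool (i = j)) k * w j) +
      B k * (\<Sum>j<d. linrec d A B (\<lambda>i. of_bool (i = j)) (Suc k) * w j)"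
    by (simp only: linrec_step[OF assms] distrib_right sum.distrib sum_distrib_left mult.assoc)
qed

section \<open>Right division by L and the criterion for a kernel of full size\<close>

context finite_fixed_field
begin

lemma iter_L_map:
  "(\<sigma> ^^ k) (L_map \<sigma> d a b x) =
     (\<sigma> ^^ k) a * (\<sigma> ^^ k) x + (\<sigma> ^^ k) b * (\<sigma> ^^ Suc k) x - (\<sigma> ^^ (k + d)) x"
proof -
  have "(\<sigma> ^^ k) (\<sigma> x) = (\<sigma> ^^ Suc k) x" by (simp add: funpow_swap1)
  then show ?thesis by (simp add: L_map_def diff iter_add iter_mult funpow_add del: funpow.simps)
qed

lemma L_map_add: "L_map \<sigma> d a b (x + y) = L_map \<sigma> d a b x + L_map \<sigma> d a b y"
  by (simp add: L_map_def \<sigma>_add iter_add algebra_simps)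

lemma card_ker_L_map_le:
  assumes "d \<ge> 2"
  shows "card (ker (L_map \<sigma> d a b)) \<le> q ^ d"
proof -
  \<comment> \<open>L is a \<sigma>-polynomial of \<sigma>-degree \<open>d\<close> with leading
    coefficient -1; \<open>d \<ge> 2\<close> keeps the indices 0, 1 and \<open>d\<close>
    distinct.\<close>
  let ?p = "\<lambda>i. if i = 0 then a else if i = 1 then b else if i = d then -1 else 0"
  have "L_map \<sigma> d a b x = (\<Sum>i<Suc d. ?p i * (\<sigma> ^^ i) x)" for x
  proof -
    have "(\<Sum>i<Suc d. ?p i * (\<sigma> ^^ i) x) = (\<Sum>i\<in>{0, 1, d}. ?p i * (\<sigma> ^^ i) x)"
      using assms by (intro sum.mono_neutral_right) auto
    then show ?thesis using assms by (simp add: L_map_def)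
  qed
  then have "ker (L_map \<sigma> d a b) = {x. (\<Sum>i<Suc d. ?p i * (\<sigma> ^^ i) x) = 0}"
    by (simp only: ker_def)
  also have "card \<dots> \<le> q ^ d"
    using assms by (intro card_roots_le) auto
  finally show ?thesis .
qed

text \<open>Right division of \<open>\<sigma> ^^ k\<close> by L: the recurrence computes the
  remainder, and the quotient \<open>r\<close> has \<sigma>-degree \<open>k - d\<close> with leading
  coefficient -1 once \<open>d \<le> k\<close>. The common summation bound \<open>n\<close> allows
  the two quotients from the induction to be added directly.\<close>

lemma linrec_remainder:
  assumes "d \<ge> 2" "k \<le> n"
  shows "\<exists>r. (\<forall>i. k < i + d \<longrightarrow> r i = 0) \<and> (d \<le> k \<longrightarrow> r (k - d) = -1) \<and>
    (\<forall>x. (\<sigma> ^^ k) x = linrec d (\<lambda>k. (\<sigma> ^^ k) a) (\<lambda>k. (\<sigma> ^^ k) b) (\<lambda>j. (\<sigma> ^^ j) x) k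
       + (\<Sum>i<n. r i * (\<sigma> ^^ i) (L_map \<sigma> d a b x)))"
  using \<open>k \<le> n\<close>
proof (induction k rule: less_induct)
  case (less k)
  let ?z = "\<lambda>x. linrec d (\<lambda>k. (\<sigma> ^^ k) a) (\<lambda>k. (\<sigma> ^^ k) b) (\<lambda>j. (\<sigma> ^^ j) x)"
  show ?case
  proof (cases "k < d")
    case True
    then show ?thesis by (intro exI[of _ "\<lambda>_. 0"]) (simp add: linrec_init)
  next
    case False
    then obtain l where l: "k = l + d" by (metis le_Suc_ex linorder_not_less add.commute)
    obtain r1 where r1: "\<forall>i. l < i + d \<longrightarrow> r1 i = 0"
        "\<And>x. (\<sigma> ^^ l) x = ?z x l + (\<Sum>i<n. r1 i * (\<sigma> ^^ i) (L_map \<sigma> d a b x))"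
      using less.IH[of l] less.prems l assms(1) by auto
    obtain r2 where r2: "\<forall>i. Suc l < i + d \<longrightarrow> r2 i = 0"
        "\<And>x. (\<sigma> ^^ Suc l) x = ?z x (Suc l) + (\<Sum>i<n. r2 i * (\<sigma> ^^ i) (L_map \<sigma> d a b x))"
      using less.IH[of "Suc l"] less.prems l assms(1) by auto
    \<comment> \<open>Applying \<open>\<sigma> ^^ l\<close> to L expresses
      \<open>\<sigma> ^^ (l + d)\<close> through \<open>\<sigma> ^^ l\<close>,
      \<open>\<sigma> ^^ Suc l\<close> and the composite of \<open>\<sigma> ^^ l\<close> with L,
      subtracted once; the last contributes the new leading term.\<close>
    define r where "r i = (\<sigma> ^^ l) a * r1 i + (\<sigma> ^^ l) b * r2 i - of_bool (i = l)" for i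
    have "(\<sigma> ^^ k) x = ?z x k + (\<Sum>i<n. r i * (\<sigma> ^^ i) (L_map \<sigma> d a b x))" for x
    proof -
      let ?y = "L_map \<sigma> d a b x"
      have "l < n" using less.prems l assms(1) by simp
      have "(\<Sum>i<n. of_bool (i = l) * (\<sigma> ^^ i) ?y) = (\<Sum>i<n. if i = l then (\<sigma> ^^ i) ?y else 0)"
        by (intro sum.cong) auto
      also have "\<dots> = (\<sigma> ^^ l) ?y" using \<open>l < n\<close> by simp
      finally have delta: "(\<Sum>i<n. of_bool (i = l) * (\<sigma> ^^ i) ?y) = (\<sigma> ^^ l) ?y" .
      have "(\<Sum>i<n. r i * (\<sigma> ^^ i) ?y) =
          (\<sigma> ^^ l) a * (\<Sum>i<n. r1 i * (\<sigma> ^^ i) ?y) + (\<sigma> ^^ l) b * (\<Sum>i<n. r2 i * (\<sigma> ^^ i) ?y)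
          - (\<sigma> ^^ l) ?y"
        unfolding r_def left_diff_distrib distrib_right sum_subtractf sum.distrib delta
        by (simp add: sum_distrib_left mult.assoc)
      moreover have "(\<sigma> ^^ k) x =
          (\<sigma> ^^ l) a * (\<sigma> ^^ l) x + (\<sigma> ^^ l) b * (\<sigma> ^^ Suc l) x - (\<sigma> ^^ l) ?y"
        unfolding iter_L_map l by (simp del: funpow.simps)
      moreover have "?z x k = (\<sigma> ^^ l) a * ?z x l + (\<sigma> ^^ l) b * ?z x (Suc l)"
        unfolding l by (rule linrec_step[OF assms(1)])
      ultimately show ?thesis
        using r1(2)[of x] r2(2)[of x] by (simp only: distrib_left diff_conv_add_uminus add_ac)
    qed
    moreover have "\<forall>i. k < i + d \<longrightarrow> r i = 0" "r l = -1"
      using r1(1) r2(1) assms(1) by (auto simp: r_def l)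
    ultimately show ?thesis using l by (intro exI[of _ r]) simp
  qed
qed

text \<open>On the kernel, \<open>z n = z 0\<close> is a relation of \<sigma>-degree below
  \<open>d\<close>; if it has \<open>q ^ d\<close> roots, its coefficients vanish. Conversely, a
  remainder equal to the identity means that the quotient Q of \<sigma>-degree \<open>n - d\<close>
  kills the image of L. As Q has at most \<open>q ^ (n - d)\<close> roots, counting the whole field
  through L forces at least \<open>q ^ d\<close> elements into the kernel.\<close>

theorem card_ker_L_map_eq_iff:
  assumes d: "d \<ge> 2" and n: "n > 0" and id: "\<And>x. (\<sigma> ^^ n) x = x"
    and card: "CARD('a) = q ^ n" and q: "q > 1"
  shows "card (ker (L_map \<sigma> d a b)) = q ^ d \<longleftrightarrow>
    (\<forall>w. linrec d (\<lambda>k. (\<sigma> ^^ k) a) (\<lambda>k. (\<sigma> ^^ k) b) w n = w 0)"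
    (is "card ?K = _ \<longleftrightarrow> (\<forall>w. ?z w n = w 0)")
proof
  assume K: "card ?K = q ^ d"
  define c where "c j = ?z (\<lambda>i. of_bool (i = j)) n" for j
  have *: "?z w n = (\<Sum>j<d. c j * w j)" for w
    unfolding c_def by (rule linrec_linear[OF d])
  have delta: "(\<Sum>j<d. of_bool (j = 0) * w j) = w 0" for w :: "nat \<Rightarrow> 'a"
  proof -
    have "(\<Sum>j<d. of_bool (j = 0) * w j) = (\<Sum>j<d. if j = 0 then w j else 0)"
      by (intro sum.cong) auto
    then show ?thesis using d by simp
  qed
  have "?K \<subseteq> {x. (\<Sum>j<d. (c j - of_bool (j = 0)) * (\<sigma> ^^ j) x) = 0}"
  proof
    fix x assume "x \<in> ?K"
    then have "(\<sigma> ^^ k) x = ?z (\<lambda>j. (\<sigma> ^^ j) x) k" for k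
      using iter_L_map[of _ d a b x]
      by (intro linrec_unique[OF d]) (simp_all add: ker_def zero del: funpow.simps)
    from this[of n] have "(\<Sum>j<d. c j * (\<sigma> ^^ j) x) = x" by (simp add: id *)
    then show "x \<in> {x. (\<Sum>j<d. (c j - of_bool (j = 0)) * (\<sigma> ^^ j) x) = 0}"
      by (simp add: left_diff_distrib sum_subtractf delta)
  qed
  then have "card {x. (\<Sum>j<d. (c j - of_bool (j = 0)) * (\<sigma> ^^ j) x) = 0} \<ge> q ^ d"
    unfolding K[symmetric] by (intro card_mono) auto
  from coeffs_eq_0_if_card_roots[OF this _ q]
  have "c j - of_bool (j = 0) = 0" if "j < d" for j using that .
  then have "(\<Sum>j<d. c j * w j) = (\<Sum>j<d. of_bool (j = 0) * w j)" for w
    by (intro sum.cong) auto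
  then show "\<forall>w. ?z w n = w 0" by (simp add: * delta)
next
  assume z: "\<forall>w. ?z w n = w 0"
  \<comment> \<open>Below \<open>d\<close> the value at \<open>n\<close> is the free initial value
    \<open>w n\<close>, which is independent of \<open>w 0\<close> because
    \<open>n > 0\<close>.\<close>
  have "d \<le> n"
  proof (rule ccontr)
    assume "\<not> d \<le> n"
    then show False
      using z[rule_format, of "\<lambda>i. of_bool (i = n)"] n by (simp add: linrec_init)
  qed
  obtain r where r: "\<forall>i. n < i + d \<longrightarrow> r i = 0" "r (n - d) = -1"
      "\<And>x. (\<sigma> ^^ n) x = ?z (\<lambda>j. (\<sigma> ^^ j) x) n + (\<Sum>i<n. r i * (\<sigma> ^^ i) (L_map \<sigma> d a b x))"
    using linrec_remainder[OF d order_refl, of n a b] \<open>d \<le> n\<close> by auto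
  have Q: "(\<Sum>i<n. r i * (\<sigma> ^^ i) (L_map \<sigma> d a b x)) = 0" for x
    using r(3)[of x] z by (simp add: id)
  let ?Z = "{y. (\<Sum>i<n. r i * (\<sigma> ^^ i) y) = 0}"
  have "q ^ n = card {x. L_map \<sigma> d a b x \<in> ?Z}" using Q by (simp add: card)
  also have "\<dots> \<le> card ?Z * card {x. L_map \<sigma> d a b x = 0}"
    by (rule card_additive_preimage_le) (auto simp: L_map_add)
  also have "\<dots> \<le> q ^ (n - d) * card ?K"
    unfolding ker_def using r(1,2) d \<open>d \<le> n\<close> by (intro mult_right_mono card_roots_le) auto
  finally have "q ^ (n - d) * q ^ d \<le> q ^ (n - d) * card ?K"
    using \<open>d \<le> n\<close> by (simp flip: power_add)
  then have "q ^ d \<le> card ?K" using q by simp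
  then show "card ?K = q ^ d" using card_ker_L_map_le[OF d, of a b] by simp
qed

end

section \<open>Weighted descents\<close>

text \<open>Total weight of the descents from \<open>m * d + j\<close> in \<open>m\<close> steps, of which \<open>v\<close> go down by
  \<open>d - 1\<close> (weight \<open>B\<close>) and the others by \<open>d\<close> (weight \<open>A\<close>).\<close>

primrec walk_sum ::
    "nat \<Rightarrow> (nat \<Rightarrow> 'a) \<Rightarrow> (nat \<Rightarrow> 'a) \<Rightarrow> nat \<Rightarrow> nat \<Rightarrow> nat \<Rightarrow> 'a::comm_ring_1" where
  "walk_sum d A B 0 j v = (if v = 0 then 1 else 0)"
| "walk_sum d A B (Suc m) j v = A (m * d + j) * walk_sum d A B m j v
     + (if v = 0 then 0 else B (m * d + j) * walk_sum d A B m (Suc j) (v - 1))"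

lemma walk_sum_eq_0: "m < v \<Longrightarrow> walk_sum d A B m j v = 0"
  by (induction m arbitrary: j v) auto

lemma walk_sum_0: "walk_sum d A B m j 0 = (\<Prod>i<m. A (i * d + j))"
  by (induction m) (simp_all add: mult.commute)

text \<open>With \<open>i + 1\<close> steps left, \<open>m - 1 - i\<close> steps by
  \<open>d - 1\<close> have been made, and each has raised the offset \<open>j\<close> by
  one.\<close>

lemma walk_sum_full: "walk_sum d A B m j m = (\<Prod>i<m. B (i * d + j + (m - 1 - i)))"
proof (induction m arbitrary: j)
  case (Suc m)
  have "(\<Prod>i<m. B (i * d + Suc j + (m - 1 - i))) = (\<Prod>i<m. B (i * d + j + (m - i)))"
    by (intro prod.cong arg_cong[of _ _ B]) auto
  then show ?case by (simp add: walk_sum_eq_0 Suc mult.commute)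
qed simp

text \<open>The recurrence is unrolled \<open>m\<close> times. A step by \<open>d - 1\<close> leaves
  the offset one higher than a step by \<open>d\<close>, so all descents with \<open>v\<close> such
  steps end at \<open>j + v\<close>.\<close>

lemma linrec_walk_sum:
  assumes "d \<ge> 2"
  shows "linrec d A B w (m * d + j) = (\<Sum>v\<le>m. walk_sum d A B m j v * linrec d A B w (j + v))"
    (is "?z (m * d + j) = _")
proof (induction m arbitrary: j)
  case (Suc m)
  have "?z (Suc m * d + j) = ?z ((m * d + j) + d)" by (simp add: algebra_simps)
  also have "\<dots> = A (m * d + j) * ?z (m * d + j) + B (m * d + j) * ?z (m * d + Suc j)"
    unfolding linrec_step[OF assms] by simp
  finally have step: "?z (Suc m * d + j) =
      A (m * d + j) * ?z (m * d + j) + B (m * d + j) * ?z (m * d + Suc j)" .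
  have A: "A (m * d + j) * ?z (m * d + j)
      = (\<Sum>v\<le>Suc m. A (m * d + j) * walk_sum d A B m j v * ?z (j + v))"
    by (simp add: Suc.IH walk_sum_eq_0 sum_distrib_left mult.assoc)
  have B: "B (m * d + j) * ?z (m * d + Suc j) = (\<Sum>v\<le>Suc m. (if v = 0 then 0
      else B (m * d + j) * walk_sum d A B m (Suc j) (v - 1)) * ?z (j + v))"
    unfolding sum.atMost_Suc_shift Suc.IH[of "Suc j"] by (simp add: sum_distrib_left mult.assoc)
  show ?case
    unfolding step A B walk_sum.simps distrib_right by (rule sum.distrib[symmetric])
qed simp

text \<open>All walks with the same number of steps of each kind carry the same weight here: with
  \<open>d * d - d + 1 = 0\<close> in the index group, a \<open>B\<close>-step multiplies \<open>d\<close> consecutive \<open>A\<close>-steps.\<close>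

lemma walk_sum_gauge:
  assumes n: "n + d = d * d + 1"
    and per: "\<And>k. A (k + n) = A k"
    and B: "\<And>k. B k = - (\<Prod>i<d. A (i * d + 1 + k))"
    and "v \<le> m"
  shows "walk_sum d A B m j v =
    (-1) ^ v * of_nat (m choose v) * (\<Prod>i<m - v + d * v. A (j + v + i * d))"
  using \<open>v \<le> m\<close>
proof (induction m arbitrary: j v)
  case 0
  then show ?case by simp
next
  case (Suc m)
  have perm: "A (k + r * n) = A k" for k r
  proof (induction r)
    case (Suc r)
    have "k + Suc r * n = k + r * n + n" by simp
    then show ?case using per[of "k + r * n"] Suc by metis
  qed simp
  \<comment> \<open>The progression from \<open>j + v\<close> with difference \<open>d\<close> and
    \<open>m - v + d * v\<close> terms continues, up to \<open>v\<close> periods, at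
    \<open>m * d + j\<close>, the index from which the next step takes its weight.\<close>
  have ind: "(m - v + d * v) * d + v = m * d + v * n" if "v \<le> m" for m v
  proof -
    obtain u where u: "m = v + u" using le_Suc_ex[OF \<open>v \<le> m\<close>] ..
    have "v * n + v * d = v * (n + d)" by (rule distrib_left[symmetric])
    also have "\<dots> = d * v * d + v" unfolding n by simp
    finally have "v * n + v * d = d * v * d + v" .
    then show ?thesis unfolding u diff_add_inverse distrib_right by linarith
  qed
  define W where "W m j v = (\<Prod>i<m - v + d * v. A (j + v + i * d))" for m j v
  have WA: "W (Suc m) j v = A (m * d + j) * W m j v" if "v \<le> m" for v
  proof -
    have "Suc m - v + d * v = Suc (m - v + d * v)" using that by simp
    moreover have "A (j + v + (m - v + d * v) * d) = A (m * d + j)"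
    proof -
      have "j + v + (m - v + d * v) * d = (m * d + j) + v * n" using ind[OF that] by linarith
      then show ?thesis by (simp only: perm)
    qed
    ultimately show ?thesis by (simp add: W_def mult.commute)
  qed
  \<comment> \<open>The starting index is unchanged since \<open>j + Suc v = Suc j + v\<close>, and
    the \<open>d\<close> factors of \<open>B\<close> are appended at the end. Each such step costs
    one sign.\<close>
  have WB: "W (Suc m) j (Suc v) = - (B (m * d + j) * W m (Suc j) v)" if "v \<le> m" for v
  proof -
    have len: "Suc m - Suc v + d * Suc v = (m - v + d * v) + d" using that by simp
    have "(\<Prod>i<l + d. f i) = (\<Prod>i<l. f i) * (\<Prod>i<d. f (l + i))" for l and f :: "nat \<Rightarrow> 'a"
      by (induction d) (simp_all add: mult.assoc)
    note fact = this[of "\<lambda>i. A (j + Suc v + i * d)" "m - v + d * v"]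
    have "A (j + Suc v + (m - v + d * v + i) * d) = A (i * d + 1 + (m * d + j))" for i
    proof -
      have "j + Suc v + (m - v + d * v + i) * d = (i * d + 1 + (m * d + j)) + v * n"
        using ind[OF that] unfolding distrib_right by linarith
      then show ?thesis by (simp only: perm)
    qed
    then show ?thesis unfolding W_def len fact B by (simp add: add_ac mult.commute)
  qed
  have IH: "walk_sum d A B m j v = (-1) ^ v * of_nat (m choose v) * W m j v" if "v \<le> m" for j v
    unfolding W_def by (rule Suc.IH[OF that])
  have a_step: "A (m * d + j) * walk_sum d A B m j v =
      (-1) ^ v * of_nat (m choose v) * W (Suc m) j v" for v
  proof (cases "v \<le> m")
    case True
    show ?thesis unfolding IH[OF True] WA[OF True] by (simp only: mult_ac)
  qed (simp add: walk_sum_eq_0 binomial_eq_0)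
  show ?case
  proof (cases v)
    case 0
    show ?thesis unfolding 0 W_def[symmetric] using a_step[of 0] by simp
  next
    case v: (Suc v')
    then have "v' \<le> m" using Suc.prems by simp
    have b_step: "B (m * d + j) * walk_sum d A B m (Suc j) v' =
        (-1) ^ v * of_nat (m choose v') * W (Suc m) j v"
      unfolding v WB[OF \<open>v' \<le> m\<close>] IH[OF \<open>v' \<le> m\<close>] power_Suc
      by (simp only: mult_ac mult_minus_left mult_minus_right minus_minus mult_1_left)
    have "walk_sum d A B (Suc m) j v =
        (-1) ^ v * of_nat (m choose v) * W (Suc m) j v + (-1) ^ v * of_nat (m choose v') * W (Suc m) j v"
      unfolding a_step[symmetric] b_step[symmetric] by (simp add: v)
    also have "\<dots> = (-1) ^ v * of_nat (Suc m choose v) * W (Suc m) j v"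
      by (simp only: v binomial_Suc_Suc of_nat_add distrib_left distrib_right add_ac)
    finally show ?thesis unfolding W_def .
  qed
qed

section \<open>Binomial coefficients modulo a prime\<close>

text \<open>The product of \<open>v\<close> and \<open>p ^ k choose v\<close> is a multiple of
  \<open>p ^ k\<close>. If the binomial were prime to \<open>p\<close>, then \<open>p ^ k\<close>
  would divide \<open>v\<close>.\<close>

lemma prime_dvd_choose_prime_power:
  assumes "prime (p::nat)" "0 < v" "v < p ^ k"
  shows "p dvd p ^ k choose v"
proof (rule ccontr)
  assume "\<not> p dvd p ^ k choose v"
  then have "coprime (p ^ k) (p ^ k choose v)"
    using assms(1) by (simp add: prime_imp_coprime)
  moreover have "p ^ k dvd (p ^ k choose v) * v"
    using times_binomial_minus1_eq[OF assms(2), of "p ^ k"] by (metis dvd_triv_left mult.commute)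
  ultimately have "p ^ k dvd v" by (simp add: coprime_dvd_mult_right_iff)
  then show False using assms(2,3) by (simp add: nat_dvd_not_less)
qed

text \<open>If \<open>p ^ e\<close> is the exact power of \<open>p\<close> in \<open>N\<close>, then
  \<open>N choose p ^ e\<close> is prime to \<open>p\<close>, as in the counting proof of Sylow's
  theorem. Hence \<open>p ^ e\<close> is not below \<open>N\<close>.\<close>

lemma eq_prime_power_if_dvd_choose:
  assumes p: "prime (p::nat)" and "N \<noteq> 0"
    and dvd: "\<And>v. 0 < v \<Longrightarrow> v < N \<Longrightarrow> p dvd N choose v"
  shows "\<exists>k. N = p ^ k"
proof -
  obtain m where m: "N = p ^ multiplicity p N * m" "\<not> p dvd m"
    using multiplicity_decompose'[of N p] assms by (metis not_prime_unit)
  let ?e = "multiplicity p N"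
  have "m > 0" using m(1) \<open>N \<noteq> 0\<close> by (cases m) auto
  have "multiplicity p (N choose p ^ ?e) = 0"
    using const_p_fac[OF \<open>m > 0\<close> p, of ?e] m not_dvd_imp_multiplicity_0 by metis
  moreover have "N choose p ^ ?e \<noteq> 0"
    using m \<open>m > 0\<close> \<open>N \<noteq> 0\<close> by (simp add: binomial_eq_0_iff not_less dvd_imp_le multiplicity_dvd)
  ultimately have "\<not> p dvd N choose p ^ ?e"
    using p by (metis multiplicity_gt_zero_iff not_prime_unit less_numeral_extra(3))
  then have "\<not> p ^ ?e < N" using dvd[of "p ^ ?e"] p by (auto simp: prime_gt_0_nat)
  moreover have "p ^ ?e \<le> N" using \<open>N \<noteq> 0\<close> by (simp add: dvd_imp_le multiplicity_dvd)
  ultimately show ?thesis by (intro exI[of _ ?e]) simp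
qed

section \<open>Finite fields and their norms\<close>

lemma card_power_fixed_le:
  assumes "r \<ge> 2"
  shows "card {x::'a::{field,finite}. x ^ r = x} \<le> r"
proof -
  let ?p = "Polynomial.monom 1 r - Polynomial.monom 1 1 :: 'a poly"
  have "Polynomial.coeff ?p r = 1" using assms by simp
  then have "?p \<noteq> 0" by (metis Polynomial.coeff_0 zero_neq_one)
  then have "card {x. poly ?p x = 0} \<le> Polynomial.degree ?p" by (rule card_poly_roots_bound)
  also have "\<dots> \<le> r"
    using assms by (intro degree_diff_le) (auto intro: order.trans[OF degree_monom_le])
  finally show ?thesis by (simp add: poly_monom)
qed

text \<open>The type is viewed as a ring with carrier \<open>UNIV\<close>, so that facts about its
  finite group of units apply: it is cyclic, and Lagrange's theorem gives the power
  identity.\<close>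

lemma
  shows finite_field_generator: "\<exists>g::'a::{field,finite}. \<forall>x. x \<noteq> 0 \<longrightarrow> (\<exists>i::nat. x = g ^ i)"
    and finite_field_power_card: "(x::'a) ^ CARD('a) = x"
proof -
  define R :: "'a ring" where "R = \<lparr>carrier = (UNIV::'a set), mult = (*), one = 1, zero = 0, add = (+)\<rparr>"
  have [simp]: "carrier R = UNIV" "x \<otimes>\<^bsub>R\<^esub> y = x * y" "\<one>\<^bsub>R\<^esub> = 1" "\<zero>\<^bsub>R\<^esub> = 0" "x \<oplus>\<^bsub>R\<^esub> y = x + y" for x y :: 'a
    by (simp_all add: R_def)
  have "cring R"
  proof (intro cringI abelian_groupI comm_monoidI)
    fix x
    show "\<exists>y\<in>carrier R. y \<oplus>\<^bsub>R\<^esub> x = \<zero>\<^bsub>R\<^esub>" by (auto intro: exI[of _ "- x"])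
  qed (auto simp: algebra_simps)
  then interpret cring R .
  have "Units R = UNIV - {0}"
  proof -
    have "\<exists>y. y * x = 1 \<and> x * y = 1" if "x \<noteq> 0" for x :: 'a
      using that by (intro exI[of _ "inverse x"]) simp
    then show ?thesis unfolding Units_def by auto
  qed
  then interpret F: field R
    by unfold_locales auto
  have pow: "x [^]\<^bsub>R\<^esub> i = x ^ i" for x and i :: nat
    by (induction i) (simp_all add: mult.commute)
  obtain g where "carrier (mult_of R) = {g [^]\<^bsub>R\<^esub> i | i::nat. i \<in> UNIV}"
    using F.finite_field_mult_group_has_gen[OF finite] by blast
  then have "\<forall>x. x \<noteq> 0 \<longrightarrow> (\<exists>i::nat. x = g ^ i)" by (auto simp: pow set_eq_iff)
  then show "\<exists>g::'a. \<forall>x. x \<noteq> 0 \<longrightarrow> (\<exists>i::nat. x = g ^ i)" ..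
  show "x ^ CARD('a) = x"
  proof (cases "x = 0")
    case False
    have "x [^]\<^bsub>mult_of R\<^esub> Coset.order (mult_of R) = \<one>\<^bsub>mult_of R\<^esub>"
      using False by (intro group.pow_order_eq_1 F.field_mult_group) simp
    then have "x ^ (CARD('a) - 1) = 1" by (simp add: pow nat_pow_mult_of Coset.order_def card_Diff_singleton)
    then have "x ^ Suc (CARD('a) - 1) = x" unfolding power_Suc by simp
    moreover have "Suc (CARD('a) - 1) = CARD('a)" using finite_UNIV_card_ge_0[where ?'a='a] by simp
    ultimately show ?thesis by simp
  qed (simp add: finite_UNIV_card_ge_0)
qed

lemma field_endomorphism_power:
  assumes "q = CHAR('a::{field,finite}) ^ e"
  shows "field_endomorphism (\<lambda>x::'a. x ^ (q ^ s))"
proof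
  have "prime CHAR('a)"
    using finite_imp_CHAR_pos[where ?'a='a] prime_CHAR_semidom[where ?'a='a] by simp
  then show "(x + y) ^ (q ^ s) = x ^ (q ^ s) + y ^ (q ^ s)" for x y :: 'a
    using assms by (intro freshmans_dream'[where n = "e * s"]) (simp_all add: power_mult)
qed (simp_all add: power_mult_distrib)

lemma prime_power_CHAR:
  assumes "CARD('a::{field,finite}) = q ^ n" and "primepow q" and "n > 0"
  shows "\<exists>e. q = CHAR('a) ^ e" "prime CHAR('a)"
proof -
  show p: "prime CHAR('a)"
    using finite_imp_CHAR_pos[where ?'a='a] prime_CHAR_semidom[where ?'a='a] by simp
  obtain r e where q: "prime r" "q = r ^ e" using assms(2) by (auto simp: primepow_def)
  have "CHAR('a) dvd r ^ (e * n)"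
    using CHAR_dvd_CARD[where ?'a='a] assms(1) q(2) by (simp add: power_mult)
  then have "CHAR('a) = r" using p q(1) by (metis prime_dvd_power primes_dvd_imp_eq)
  then show "\<exists>e. q = CHAR('a) ^ e" using q(2) by blast
qed

text \<open>A vector \<open>b\<close> outside the span of \<open>B\<close> multiplies the span by
  the number of scalars. This translates dimensions into the cardinalities that root counting
  controls.\<close>

lemma card_subspace:
  fixes scale :: "'k::{field,finite} \<Rightarrow> 'a::{ab_group_add,finite} \<Rightarrow> 'a"
  assumes "vector_space scale" and "module.subspace scale V"
  shows "card V = CARD('k) ^ vector_space.dim scale V"
proof -
  interpret vector_space scale by fact
  have "card (span B) = CARD('k) ^ card B" if "independent B" for B
    using finite[of B] that
  proof (induction B rule: finite_induct)
    case (insert b B)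
    then have b: "b \<notin> span B" "independent B" by (auto simp: independent_insert)
    have "bij_betw (\<lambda>(c, x). scale c b + x) (UNIV \<times> span B) (span (insert b B))"
      unfolding bij_betw_def
    proof
      show "inj_on (\<lambda>(c, x). scale c b + x) (UNIV \<times> span B)"
      proof (rule inj_onI, clarify)
        fix c x c' x' assume x: "x \<in> span B" "x' \<in> span B" and eq: "scale c b + x = scale c' b + x'"
        have "scale (c - c') b = x' - x" using eq by (simp add: scale_left_diff_distrib algebra_simps)
        then have "scale (c - c') b \<in> span B" using x by (simp add: span_diff)
        then have "scale (inverse (c - c')) (scale (c - c') b) \<in> span B" by (rule span_scale)
        then have "c = c'" using b(1) by (cases "c = c'") auto
        then show "c = c' \<and> x = x'" using eq by simp
      qed
      show "(\<lambda>(c, x). scale c b + x) ` (UNIV \<times> span B) = span (insert b B)"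
      proof (intro equalityI subsetI)
        fix y assume "y \<in> span (insert b B)"
        then obtain c where "y - scale c b \<in> span B" by (auto simp: span_breakdown_eq)
        then show "y \<in> (\<lambda>(c, x). scale c b + x) ` (UNIV \<times> span B)"
          by (intro image_eqI[of _ _ "(c, y - scale c b)"]) auto
      next
        fix y assume "y \<in> (\<lambda>(c, x). scale c b + x) ` (UNIV \<times> span B)"
        then obtain c x where "x \<in> span B" "y = scale c b + x" by auto
        then show "y \<in> span (insert b B)"
          by (auto simp: span_breakdown_eq intro: exI[of _ c])
      qed
    qed
    then have "card (UNIV \<times> span B :: ('k \<times> 'a) set) = card (span (insert b B))"
      by (rule bij_betw_same_card)
    then show ?case using insert b by (simp add: card_cartesian_product)
  qed simp
  moreover obtain B where "B \<subseteq> V" "independent B" "V \<subseteq> span B" "card B = dim V"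
    using basis_exists by metis
  moreover have "span B = V"
    using calculation(2-4) assms(2) span_minimal by blast
  ultimately show ?thesis by metis
qed

section \<open>Conjugates and Galois groups of finite fields\<close>

context field_endomorphism
begin

lemma map_poly_mult: "map_poly \<sigma> (p * r) = map_poly \<sigma> p * map_poly \<sigma> r"
  by (intro poly_eqI) (simp add: coeff_map_poly coeff_mult \<sigma>_zero \<sigma>_mult sum[of 1, simplified])

lemma map_poly_prod_linear:
  "map_poly \<sigma> (\<Prod>i<n::nat. [:- c i, 1:]) = (\<Prod>i<n. [:- \<sigma> (c i), 1:])"
proof (induction n)
  case (Suc n)
  then show ?case unfolding prod.lessThan_Suc map_poly_mult
    by (simp add: map_poly_pCons \<sigma>_zero \<sigma>_one minus[of 1, simplified])
qed (simp add: \<sigma>_one)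

lemma poly_map_poly: "poly (map_poly \<sigma> p) (\<sigma> x) = \<sigma> (poly p x)"
  by (induction p) (simp_all add: map_poly_pCons \<sigma>_zero \<sigma>_add \<sigma>_mult)

lemma \<sigma>_power: "\<sigma> (x ^ m) = \<sigma> x ^ m"
  by (induction m) (simp_all add: \<sigma>_one \<sigma>_mult)

lemma iter_endomorphism: "field_endomorphism (\<sigma> ^^ i)"
  by standard (simp_all add: iter_add iter_mult iter_one)

lemma iter_prod: "(\<sigma> ^^ i) (\<Prod>x\<in>X. f x) = (\<Prod>x\<in>X. (\<sigma> ^^ i) (f x))"
  by (induction X rule: infinite_finite_induct) (simp_all add: iter_one iter_mult)

lemma bij_iter:
  assumes "finite (UNIV :: 'a set)"
  shows "bij (\<sigma> ^^ i)"
proof -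
  have "inj (\<sigma> ^^ i)"
  proof (rule injI)
    fix x y assume "(\<sigma> ^^ i) x = (\<sigma> ^^ i) y"
    then have "(\<sigma> ^^ i) (x - y) = 0" by (simp add: diff)
    then show "x = y" by (simp add: iter_eq_0_iff)
  qed
  then show ?thesis using finite_UNIV_inj_surj[OF assms] by (simp add: bij_def)
qed

end

text \<open>\<theta> shifts the linear factors by one index, and periodicity closes the cycle; the
  common factor at index 0 is cancelled.\<close>

lemma prod_conjugates_fixed:
  assumes "field_endomorphism \<theta>" and per: "(\<theta> ^^ t) x = x"
  shows "map_poly \<theta> (\<Prod>i<t. [:- (\<theta> ^^ i) x, 1:]) = (\<Prod>i<t. [:- (\<theta> ^^ i) x, 1:])"
proof -
  interpret field_endomorphism \<theta> by fact
  let ?h = "\<lambda>i. [:- (\<theta> ^^ i) x, 1:]"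
  have "?h 0 * (\<Prod>i<t. ?h (Suc i)) = (\<Prod>i<Suc t. ?h i)"
    unfolding prod.lessThan_Suc_shift ..
  also have "\<dots> = ?h 0 * (\<Prod>i<t. ?h i)" using per by (simp add: mult.commute)
  finally have "(\<Prod>i<t. ?h (Suc i)) = (\<Prod>i<t. ?h i)"
    by (subst (asm) mult_cancel_left) auto
  then show ?thesis unfolding map_poly_prod_linear by simp
qed

text \<open>An automorphism over the fixed field of \<open>\<theta>\<close> permutes the \<open>\<theta>\<close>-conjugates of a generator
  of the multiplicative group, and is determined by the image of that generator.\<close>

lemma galois_group_fixed_field:
  fixes \<theta> :: "'a::{field,finite} \<Rightarrow> 'a"
  assumes \<theta>: "field_endomorphism \<theta>" and "t > 0" and per: "\<And>x. (\<theta> ^^ t) x = x"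
  shows "galois_group {x. \<theta> x = x} \<subseteq> (\<lambda>i. \<theta> ^^ i) ` {..<t}"
    and "(\<lambda>i. \<theta> ^^ i) ` {..<t} \<subseteq> galois_group {x. \<theta> x = x}"
proof
  interpret \<theta>: field_endomorphism \<theta> by fact
  fix \<phi> assume "\<phi> \<in> galois_group {x. \<theta> x = x}"
  then have \<phi>: "field_endomorphism \<phi>" "\<And>x. \<theta> x = x \<Longrightarrow> \<phi> x = x"
    by (auto simp: galois_group_def field_embedding_def field_endomorphism_def)
  interpret \<phi>: field_endomorphism \<phi> by fact
  obtain g :: 'a where g: "\<And>x. x \<noteq> 0 \<Longrightarrow> \<exists>m::nat. x = g ^ m" using finite_field_generator by metis
  \<comment> \<open>The coefficients of \<open>f\<close> lie in the fixed field of \<theta>, so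
    \<phi> maps roots of \<open>f\<close> to roots of \<open>f\<close>.\<close>
  define f where "f = (\<Prod>i<t. [:- (\<theta> ^^ i) g, 1:])"
  have "map_poly \<theta> f = f" unfolding f_def by (rule prod_conjugates_fixed[OF \<theta> per])
  then have "\<theta> (poly.coeff f m) = poly.coeff f m" for m
    using coeff_map_poly[of \<theta> f m] \<theta>.\<sigma>_zero by simp
  then have "map_poly \<phi> f = f"
    by (intro poly_eqI) (simp add: coeff_map_poly \<phi>.\<sigma>_zero \<phi>(2))
  then have root: "poly f (\<phi> g) = \<phi> (poly f g)" using \<phi>.poly_map_poly[of f g] by simp
  have "poly f g = 0" unfolding f_def poly_prod using \<open>t > 0\<close> by (auto intro!: bexI[of _ 0])
  then have "poly f (\<phi> g) = 0" using root \<phi>.\<sigma>_zero by simp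
  then obtain i where i: "i < t" "\<phi> g = (\<theta> ^^ i) g" by (auto simp: f_def poly_prod)
  interpret \<theta>i: field_endomorphism "\<theta> ^^ i" by (rule \<theta>.iter_endomorphism)
  have "\<phi> x = (\<theta> ^^ i) x" for x
  proof (cases "x = 0")
    case False
    then obtain m :: nat where "x = g ^ m" using g by blast
    then show ?thesis by (simp add: \<phi>.\<sigma>_power \<theta>i.\<sigma>_power i(2))
  qed (simp add: \<phi>.\<sigma>_zero \<theta>i.\<sigma>_zero)
  then show "\<phi> \<in> (\<lambda>i. \<theta> ^^ i) ` {..<t}" using i(1) by auto
next
  interpret \<theta>: field_endomorphism \<theta> by fact
  have "(\<theta> ^^ i) x = x" if "\<theta> x = x" for i x using that by (induction i) auto
  then show "(\<lambda>i. \<theta> ^^ i) ` {..<t} \<subseteq> galois_group {x. \<theta> x = x}"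
    using \<theta>.bij_iter
    by (auto simp: galois_group_def field_embedding_def \<theta>.iter_add \<theta>.iter_mult \<theta>.iter_one)
qed

text \<open>By \<open>order\<close> the powers of \<theta> below \<open>t\<close> are distinct, so
  the product over the Galois group can be reindexed by exponents without repetition.\<close>

lemma field_norm_fixed_field:
  fixes \<theta> :: "'a::{field,finite} \<Rightarrow> 'a"
  assumes \<theta>: "field_endomorphism \<theta>" and "t > 0" and per: "\<And>x. (\<theta> ^^ t) x = x"
    and order: "\<And>i. 0 < i \<Longrightarrow> i < t \<Longrightarrow> \<exists>x. (\<theta> ^^ i) x \<noteq> x"
  shows "field_norm {x. \<theta> x = x} a = (\<Prod>i<t. (\<theta> ^^ i) a)"
proof -
  interpret \<theta>: field_endomorphism \<theta> by fact
  have ne: "\<theta> ^^ i \<noteq> \<theta> ^^ j" if "i < j" "j < t" for i j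
  proof
    assume eq: "\<theta> ^^ i = \<theta> ^^ j"
    have "(\<theta> ^^ (j - i)) y = y" for y
    proof -
      obtain x where "y = (\<theta> ^^ i) x"
        using surjD[OF bij_is_surj[OF \<theta>.bij_iter[OF finite]]] by blast
      moreover have "(\<theta> ^^ (j - i)) ((\<theta> ^^ i) x) = (\<theta> ^^ j) x"
        using funpow_add[of "j - i" i \<theta>] \<open>i < j\<close> by simp
      ultimately show ?thesis using eq by simp
    qed
    then show False using order[of "j - i"] that by (simp add: less_imp_diff_less)
  qed
  have "inj_on (\<lambda>i. \<theta> ^^ i) {..<t}"
    by (rule linorder_inj_onI) (use ne in auto)
  moreover have "galois_group {x. \<theta> x = x} = (\<lambda>i. \<theta> ^^ i) ` {..<t}"
    using galois_group_fixed_field[OF \<theta> \<open>t > 0\<close> per] by blast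
  ultimately show ?thesis unfolding field_norm_def by (simp add: prod.reindex)
qed

section \<open>Frobenius powers, their fixed fields and their norms\<close>

lemma frob_iter: "(frob q s ^^ i) x = x ^ (q ^ (s * i))"
  by (induction i) (simp_all add: frob_def power_mult[symmetric] power_add mult.commute)

text \<open>The element is fixed by the Frobenius powers with exponents \<open>i\<close> and
  \<open>n\<close>, hence, by Bezout's identity, by the one with exponent
  \<open>gcd i n\<close>.\<close>

lemma power_q_gcd:
  assumes card: "CARD('a::{field,finite}) = q ^ n" and x: "(x::'a) ^ (q ^ i) = x"
  shows "x ^ (q ^ gcd i n) = x"
proof (cases "i = 0")
  case True
  then show ?thesis using finite_field_power_card[of x] card by simp
next
  case False
  have mult: "x ^ (q ^ (j * m)) = x" if "x ^ (q ^ j) = x" for j m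
    using that by (induction m) (simp_all add: power_add power_mult)
  obtain u v where uv: "i * u = n * v + gcd i n" using bezout_nat[OF False] by blast
  have "x = x ^ (q ^ (n * v + gcd i n))" using mult[OF x, of u] uv by simp
  also have "\<dots> = (x ^ (q ^ (n * v))) ^ (q ^ gcd i n)" by (simp add: power_add power_mult)
  also have "\<dots> = x ^ (q ^ gcd i n)"
    using mult[of n v] finite_field_power_card[of x] card by simp
  finally show ?thesis by simp
qed

lemma frob_fixed_eq_subfield:
  assumes "CARD('a::{field,finite}) = q ^ n"
  shows "{x::'a. frob q r x = x} = subfield_of_order (q ^ gcd r n)"
proof -
  have "x ^ (q ^ r) = x" if "x ^ (q ^ gcd r n) = x" for x :: 'a
  proof -
    have "x ^ (q ^ (gcd r n * m)) = x" for m
      using that by (induction m) (simp_all add: power_add power_mult)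
    then show ?thesis by (metis dvdE gcd_dvd1)
  qed
  then show ?thesis using power_q_gcd[OF assms, of _ r] by (auto simp: frob_def subfield_of_order_def)
qed

text \<open>Otherwise the whole field would consist of roots of a polynomial of degree
  \<open>q ^ gcd i n\<close>, which is less than \<open>q ^ n\<close>.\<close>

lemma dvd_if_frob_id:
  assumes card: "CARD('a::{field,finite}) = q ^ n" and "q \<ge> 2" "n > 0"
    and "\<And>x::'a. x ^ (q ^ i) = x"
  shows "n dvd i"
proof -
  have "x ^ (q ^ gcd i n) = x" for x :: 'a using power_q_gcd[OF card] assms(4) by blast
  then have "(UNIV :: 'a set) = {x. x ^ (q ^ gcd i n) = x}" by auto
  moreover have "q ^ 1 \<le> q ^ gcd i n"
    using \<open>q \<ge> 2\<close> \<open>n > 0\<close> by (intro power_increasing) (simp_all add: Suc_le_eq)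
  ultimately have "q ^ n \<le> q ^ gcd i n"
    using card_power_fixed_le[of "q ^ gcd i n", where ?'a='a] card \<open>q \<ge> 2\<close> by simp
  then have "n \<le> gcd i n" using \<open>q \<ge> 2\<close> by (simp add: power_le_imp_le_exp)
  then have "gcd i n = n" using \<open>n > 0\<close> by (simp add: dvd_imp_le antisym)
  then show ?thesis by (metis gcd_dvd1)
qed

text \<open>The Frobenius power with exponent \<open>r\<close> has order
  \<open>n div gcd r n\<close> and therefore generates the Galois group over its fixed
  field.\<close>

lemma field_norm_eq_prod_frob:
  fixes a :: "'a::{field,finite}"
  assumes card: "CARD('a) = q ^ n" and "primepow q" and "n > 0"
  shows "field_norm (subfield_of_order (q ^ gcd r n)) a = (\<Prod>i<n div gcd r n. (frob q r ^^ i) a)"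
  unfolding frob_fixed_eq_subfield[OF card, symmetric]
proof (rule field_norm_fixed_field)
  let ?m = "gcd r n"
  have q: "q \<ge> 2" using primepow_gt_Suc_0[OF \<open>primepow q\<close>] by simp
  obtain e where "q = CHAR('a) ^ e" using prime_power_CHAR[OF assms] by blast
  then show "field_endomorphism (frob q r :: 'a \<Rightarrow> 'a)"
    unfolding frob_def[abs_def] by (rule field_endomorphism_power)
  have t: "n = n div ?m * ?m" by simp
  show "n div ?m > 0" using \<open>n > 0\<close> t by (metis gr0I mult_0)
  obtain r' where r': "r = r' * ?m" by (metis dvdE gcd_dvd1 mult.commute)
  have cop: "coprime r' (n div ?m)"
    using \<open>n > 0\<close> by (intro gcd_coprime[OF _ r' t]) simp
  show "(frob q r ^^ (n div ?m)) x = x" for x :: 'a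
  proof -
    have "r * (n div ?m) = n * r'" 
      by (subst r') (simp add: mult_ac)
    moreover have "x ^ (q ^ (n * j)) = x" for j
      using finite_field_power_card[of x] card by (induction j) (simp_all add: power_add power_mult)
    ultimately show ?thesis by (simp add: frob_iter)
  qed
  show "\<exists>x::'a. (frob q r ^^ i) x \<noteq> x" if i: "0 < i" "i < n div ?m" for i
  proof (rule ccontr)
    assume "\<not> ?thesis"
    then have "n dvd r * i" by (intro dvd_if_frob_id[OF card q \<open>n > 0\<close>]) (simp add: frob_iter)
    moreover have "r * i = (r' * i) * ?m" by (subst r') (simp add: mult_ac)
    ultimately have "n div ?m * ?m dvd (r' * i) * ?m" using t by simp
    then have "n div ?m dvd r' * i"
      using \<open>n > 0\<close> by (subst (asm) dvd_times_right_cancel_iff) simp_all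
    then have "n div ?m dvd i" using cop by (simp add: coprime_commute coprime_dvd_mult_right_iff)
    then show False using i by (simp add: nat_dvd_not_less)
  qed
qed

section \<open>Coefficients of the recurrence\<close>

text \<open>The initial value at 0 reaches later indices only through the weight \<open>A 0\<close>
  at index \<open>d\<close>. This will exclude \<open>a = 0\<close>.\<close>

lemma linrec_delta_0:
  assumes "d \<ge> 2" and "A 0 = 0" and "k > 0"
  shows "linrec d A B (\<lambda>i. of_bool (i = 0)) k = 0"
  using \<open>k > 0\<close>
proof (induction k rule: less_induct)
  case (less k)
  show ?case
  proof (cases "k < d")
    case False
    then obtain l where k: "k = l + d" by (metis le_Suc_ex linorder_not_less add.commute)
    have "linrec d A B (\<lambda>i. of_bool (i = 0)) (Suc l) = 0" using less.IH[of "Suc l"] k assms(1) by simp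
    moreover have "A l * linrec d A B (\<lambda>i. of_bool (i = 0)) l = 0"
      using less.IH[of l] k assms by (cases "l = 0") auto
    ultimately show ?thesis unfolding k linrec_step[OF assms(1)] by simp
  qed (use less.prems in \<open>simp add: linrec_init\<close>)
qed

text \<open>Descents with \<open>v > 0\<close> steps by \<open>d - 1\<close> end at
  \<open>j + v\<close>. Either this is an initial index other than \<open>j\<close>, or one more
  step leads to two indices below \<open>j\<close>, because \<open>v \<le> d - 2\<close>. Only
  \<open>v = 0\<close> survives.\<close>

lemma linrec_delta_residue:
  assumes "t + 2 \<le> d" and "j < d"
  shows "linrec d A B (\<lambda>i. of_bool (i = j)) (t * d + j) = (\<Prod>i<t. A (i * d + j))"
proof -
  have d: "d \<ge> 2" using assms(1) by simp
  let ?z = "linrec d A B (\<lambda>i. of_bool (i = j))"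
  have z: "?z (j + v) = 0" if "0 < v" "v \<le> t" for v
  proof (cases "j + v < d")
    case True
    then show ?thesis using that by (simp add: linrec_init)
  next
    case False
    define l where "l = j + v - d"
    have l: "j + v = l + d" "Suc l < j" "j < d" using False that assms by (auto simp: l_def)
    show ?thesis unfolding l(1) linrec_step[OF d] using l(2,3) by (simp add: linrec_init)
  qed
  have "?z (t * d + j) = (\<Sum>v\<le>t. walk_sum d A B t j v * ?z (j + v))"
    by (rule linrec_walk_sum[OF d])
  also have "\<dots> = (\<Sum>v\<in>{0}. walk_sum d A B t j v * ?z (j + v))"
    by (intro sum.mono_neutral_right) (auto simp: z)
  finally show ?thesis using assms(2) by (simp add: linrec_init walk_sum_0)
qed

lemma linrec_multiple:
  assumes "d \<ge> 2" and "t < d"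
  shows "linrec d A B w (t * d) = (\<Sum>v\<le>t. walk_sum d A B t 0 v * w v)"
  using linrec_walk_sum[OF assms(1), of A B w t 0] assms(2) by (simp add: linrec_init)

lemma walk_sum_no_B: "v > 0 \<Longrightarrow> walk_sum d A (\<lambda>_. 0) m j v = 0"
  by (induction m) auto

text \<open>After \<open>d - 1\<close> steps the descents end at \<open>1 + v\<close>. All these are
  initial indices except the last, \<open>d\<close>, which one further step resolves into
  \<open>A 0 * w 0 + B 0 * w 1\<close>. The conditions compare coefficients of the
  \<open>w i\<close>.\<close>

lemma linrec_periodic_iff:
  fixes A B :: "nat \<Rightarrow> 'a::comm_ring_1"
  assumes "d \<ge> 3"
  defines "T \<equiv> walk_sum d A B (d - 1) 1"
  shows "(\<forall>w. linrec d A B w (d * (d - 1) + 1) = w 0) \<longleftrightarrow>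
    T (d - 1) * A 0 = 1 \<and> T 0 + T (d - 1) * B 0 = 0 \<and> (\<forall>v. 0 < v \<and> v < d - 1 \<longrightarrow> T v = 0)"
proof -
  have d: "d \<ge> 2" using assms(1) by simp
  have eq: "linrec d A B w (d * (d - 1) + 1) =
      (\<Sum>v<d - 1. T v * w (Suc v)) + T (d - 1) * (A 0 * w 0 + B 0 * w 1)" for w
  proof -
    have "linrec d A B w (d * (d - 1) + 1) = (\<Sum>v\<le>d - 1. T v * linrec d A B w (1 + v))"
      using linrec_walk_sum[OF d, of A B w "d - 1" 1] by (simp only: T_def mult.commute)
    also have "{..d - 1} = insert (d - 1) {..<d - 1}" by auto
    also have "(\<Sum>v\<in>\<dots>. T v * linrec d A B w (1 + v)) =
        T (d - 1) * linrec d A B w d + (\<Sum>v<d - 1. T v * linrec d A B w (1 + v))"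
      using assms(1) by simp
    also have "(\<Sum>v<d - 1. T v * linrec d A B w (1 + v)) = (\<Sum>v<d - 1. T v * w (Suc v))"
      by (intro sum.cong) (auto simp: linrec_init)
    also have "linrec d A B w d = A 0 * w 0 + B 0 * w 1"
      using linrec_step[OF d, of A B w 0] assms(1) by (simp add: linrec_init)
    finally show ?thesis by (simp only: add.commute)
  qed
  have first: "(\<Sum>v<d - 1. f v) = f 0 + (\<Sum>v\<in>{0<..<d - 1}. f v)" for f :: "nat \<Rightarrow> 'a"
  proof -
    have "{..<d - 1} = insert 0 {0<..<d - 1}" using assms(1) by auto
    then show ?thesis by simp
  qed
  show ?thesis
  proof (intro iffI conjI; (intro allI impI)?)
    assume w: "\<forall>w. linrec d A B w (d * (d - 1) + 1) = w 0"
    show "T (d - 1) * A 0 = 1"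
      using w[unfolded eq, rule_format, of "\<lambda>i. of_bool (i = 0)"] by simp
    have delta: "(\<Sum>u<d - 1. T u * of_bool (Suc u = Suc v)) = T v" if "v < d - 1" for v
    proof -
      have "(\<Sum>u<d - 1. T u * of_bool (Suc u = Suc v)) = (\<Sum>u<d - 1. if u = v then T u else 0)"
        by (intro sum.cong) auto
      then show ?thesis using that by simp
    qed
    show "T 0 + T (d - 1) * B 0 = 0"
      using w[unfolded eq, rule_format, of "\<lambda>i. of_bool (i = Suc 0)"] delta[of 0] assms(1) by simp
    show "T v = 0" if "0 < v \<and> v < d - 1" for v
      using w[unfolded eq, rule_format, of "\<lambda>i. of_bool (i = Suc v)"] delta[of v] that by simp
  next
    assume *: "T (d - 1) * A 0 = 1 \<and> T 0 + T (d - 1) * B 0 = 0 \<and>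
      (\<forall>v. 0 < v \<and> v < d - 1 \<longrightarrow> T v = 0)"
    fix w
    have "linrec d A B w (d * (d - 1) + 1) =
        (T (d - 1) * A 0) * w 0 + (T 0 + T (d - 1) * B 0) * w 1"
    proof -
      have "(\<Sum>v\<in>{0<..<d - 1}. T v * w (Suc v)) = 0"
        using * by (intro sum.neutral) auto
      then show ?thesis unfolding eq first by (simp add: distrib_left distrib_right mult.assoc)
    qed
    then show "linrec d A B w (d * (d - 1) + 1) = w 0" using * by simp
  qed
qed

section \<open>Kernels of maximal dimension\<close>

lemma CHAR_eq_if_CARD_power:
  assumes "CARD('k::{field,finite}) = q" "CARD('a::{field,finite}) = q ^ n" "primepow q" "n > 0"
  shows "CHAR('k) = CHAR('a)"
proof -
  obtain e where "q = CHAR('a) ^ e" using prime_power_CHAR[OF assms(2-4)] by blast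
  then have "CHAR('k) dvd CHAR('a) ^ e" using CHAR_dvd_CARD[where ?'a='k] assms(1) by simp
  moreover have k: "prime CHAR('k)"
    using prime_power_CHAR(2)[of q 1, where ?'a='k] assms(1,3) by simp
  ultimately have "CHAR('k) dvd CHAR('a)" by (rule prime_dvd_power[rotated])
  then show ?thesis by (rule primes_dvd_imp_eq[OF k prime_power_CHAR(2)[OF assms(2-4)]])
qed

section \<open>The kernel of L in the setting of the theorem\<close>

context
  fixes q d n s :: nat
    and \<iota> :: "'k::{field,finite} \<Rightarrow> 'a::{field,finite}"
    and \<sigma> :: "'a \<Rightarrow> 'a"
  assumes q: "primepow q" and card_k: "CARD('k) = q" and card_a: "CARD('a) = q ^ n"
    and \<iota>: "field_embedding \<iota>"
    and n: "n > 0" and s: "s > 0" and d: "d \<ge> 3" and gcd: "gcd s n = 1"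
    and \<sigma>: "\<sigma> = frob q s"
begin

lemma q_ge_2: "q \<ge> 2"
  using primepow_gt_Suc_0[OF q] by simp

text \<open>Since \<open>s\<close> and \<open>n\<close> are coprime, the fixed points of \<sigma>
  are the roots of \<open>x ^ q = x\<close>.\<close>

lemma finite_fixed_field_\<sigma>: "finite_fixed_field \<sigma> q"
proof -
  obtain e where "q = CHAR('a) ^ e" using prime_power_CHAR[OF card_a q n] by blast
  then have "field_endomorphism \<sigma>"
    unfolding \<sigma> frob_def[abs_def] by (rule field_endomorphism_power)
  moreover have "card {x. \<sigma> x = x} \<le> q"
    unfolding \<sigma> frob_fixed_eq_subfield[OF card_a] gcd subfield_of_order_def
    using card_power_fixed_le[OF q_ge_2, where ?'a='a] by simp
  ultimately show ?thesis by (simp add: finite_fixed_field_def finite_fixed_field_axioms_def)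
qed

interpretation finite_fixed_field \<sigma> q by (rule finite_fixed_field_\<sigma>)

lemma \<sigma>_period: "(\<sigma> ^^ n) x = x"
proof -
  have "x ^ (q ^ (n * j)) = x" for j
    using finite_field_power_card[of x] card_a by (induction j) (simp_all add: power_add power_mult)
  then show ?thesis unfolding \<sigma> frob_iter by (metis mult.commute)
qed

text \<open>Scalars in the image of \<open>\<iota>\<close> satisfy \<open>c ^ q = c\<close> and so
  commute with \<sigma>; the kernel is a subspace, and its dimension is determined by its
  size.\<close>

lemma card_ker_L_map: "card (ker (L_map \<sigma> d a b)) = q ^ subspace_dim \<iota> (ker (L_map \<sigma> d a b))"
proof -
  have \<iota>_add: "\<iota> (x + y) = \<iota> x + \<iota> y" and \<iota>_mult: "\<iota> (x * y) = \<iota> x * \<iota> y" and "\<iota> 1 = 1" for x y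
    using \<iota> by (auto simp: field_embedding_def)
  have vs: "vector_space (\<lambda>c x. \<iota> c * x)"
    by standard (simp_all add: \<iota>_add \<iota>_mult \<open>\<iota> 1 = 1\<close> algebra_simps)
  interpret vector_space "\<lambda>c x. \<iota> c * x" by (rule vs)
  have "\<iota> (c ^ m) = \<iota> c ^ m" for c m by (induction m) (simp_all add: \<open>\<iota> 1 = 1\<close> \<iota>_mult)
  then have "\<iota> c ^ q = \<iota> c" for c using finite_field_power_card[of c] card_k by metis
  then have "\<iota> c ^ (q ^ m) = \<iota> c" for c m by (induction m) (simp_all add: power_mult)
  then have "(\<sigma> ^^ i) (\<iota> c * x) = \<iota> c * (\<sigma> ^^ i) x" for i c x
    unfolding \<sigma> frob_iter by (simp add: power_mult_distrib)
  note scale = this[of 1, simplified] this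
  have "L_map \<sigma> d a b (\<iota> c * x) = \<iota> c * L_map \<sigma> d a b x" for c x
    unfolding L_map_def scale by (simp add: algebra_simps)
  moreover have "L_map \<sigma> d a b 0 = 0" by (simp add: L_map_def \<sigma>_zero zero)
  ultimately have "subspace (ker (L_map \<sigma> d a b))"
    by (auto simp: subspace_def ker_def L_map_add)
  from card_subspace[OF vs this] show ?thesis unfolding card_k subspace_dim_def .
qed

lemma dim_ker_L_map_le: "subspace_dim \<iota> (ker (L_map \<sigma> d a b)) \<le> d"
proof (rule power_le_imp_le_exp)
  show "q > 1" using q_ge_2 by simp
  have "d \<ge> 2" using d by simp
  from card_ker_L_map_le[OF this]
  show "q ^ subspace_dim \<iota> (ker (L_map \<sigma> d a b)) \<le> q ^ d" by (simp only: card_ker_L_map)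
qed

lemma dim_ker_L_map_eq_iff:
  "subspace_dim \<iota> (ker (L_map \<sigma> d a b)) = d \<longleftrightarrow>
     (\<forall>w. linrec d (\<lambda>k. (\<sigma> ^^ k) a) (\<lambda>k. (\<sigma> ^^ k) b) w n = w 0)"
proof -
  have "d \<ge> 2" "q > 1" using d q_ge_2 by simp_all
  then show ?thesis
    using card_ker_L_map_eq_iff[OF _ n \<sigma>_period card_a, of d a b] power_inject_exp[of q]
    by (simp only: card_ker_L_map)
qed

lemma \<sigma>_iter_eq_frob: "\<sigma> ^^ d = frob q (s * d)"
  unfolding \<sigma> by (rule ext) (simp only: frob_iter, simp only: frob_def)

lemma gcd_s_mult: "gcd (s * k) n = gcd k n"
proof -
  have "coprime n s" using gcd unfolding coprime_iff_gcd_eq_1 gcd.commute[of n] .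
  then show ?thesis by (rule gcd_mult_left_left_cancel)
qed

text \<open>One formula serves both norms: \<open>gcd d n\<close> is \<open>d\<close> if
  \<open>d\<close> divides \<open>n\<close>, and 1 if \<open>n = d * (d - 1) + 1\<close>.\<close>

lemma norm_eq_prod: "field_norm (subfield_of_order (q ^ gcd d n)) a = (\<Prod>i<n div gcd d n. (\<sigma> ^^ (i * d)) a)"
proof -
  have "(frob q (s * d) ^^ i) a = (\<sigma> ^^ (i * d)) a" for i
    unfolding \<sigma>_iter_eq_frob[symmetric] funpow_mult mult.commute[of d] ..
  then show ?thesis
    using field_norm_eq_prod_frob[OF card_a q n, of "s * d" a] unfolding gcd_s_mult by (simp only:)
qed

text \<open>With \<open>n = t * d + j\<close> and \<open>0 < j < d\<close>, the bound on
  \<open>n\<close> gives \<open>t \<le> d - 2\<close>. The coefficient of \<open>z j\<close> in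
  \<open>z n\<close> is then a product of conjugates of \<open>a\<close> and must vanish, while the
  coefficient 1 of \<open>z 0\<close> forces \<open>a \<noteq> 0\<close>.\<close>

lemma dim_ker_not_dvd:
  assumes "n \<le> d * (d - 1)" and "\<not> d dvd n"
  shows "subspace_dim \<iota> (ker (L_map \<sigma> d a b)) < d"
proof -
  have "subspace_dim \<iota> (ker (L_map \<sigma> d a b)) \<noteq> d"
  proof
    assume "subspace_dim \<iota> (ker (L_map \<sigma> d a b)) = d"
    note z = this[unfolded dim_ker_L_map_eq_iff, rule_format]
    define t j where "t = n div d" and "j = n mod d"
    have n_eq: "n = t * d + j" and j: "0 < j" "j < d"
      using assms(2) d by (auto simp: t_def j_def dvd_eq_mod_eq_0)
    have "t * d < (d - 1) * d" using n_eq j(1) assms(1) mult.commute[of d "d - 1"] by linarith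
    then have "t < d - 1" by simp
    then have t: "t + 2 \<le> d" by linarith
    have "a \<noteq> 0"
      using linrec_delta_0[of d "\<lambda>k. (\<sigma> ^^ k) a" n] z[of "\<lambda>i. of_bool (i = 0)"] n d by fastforce
    have "(\<Prod>i<t. (\<sigma> ^^ (i * d + j)) a) = 0"
      using linrec_delta_residue[OF t j(2), of "\<lambda>k. (\<sigma> ^^ k) a" "\<lambda>k. (\<sigma> ^^ k) b"]
        z[of "\<lambda>i. of_bool (i = j)"] j(1) unfolding n_eq[symmetric] by simp
    then show False using \<open>a \<noteq> 0\<close> by (simp add: iter_eq_0_iff)
  qed
  then show ?thesis using dim_ker_L_map_le[of a b] by simp
qed

text \<open>With \<open>n = t * d\<close> and \<open>t < d\<close>, all descents in \<open>t\<close>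
  steps end at initial indices. The coefficient of \<open>z t\<close> is a product of conjugates of
  \<open>b\<close>, and that of \<open>z 0\<close> is the norm of \<open>a\<close>.\<close>

lemma dim_ker_dvd:
  assumes "n \<le> d * (d - 1)" and "d dvd n"
  shows "subspace_dim \<iota> (ker (L_map \<sigma> d a b)) = d \<longleftrightarrow>
    b = 0 \<and> field_norm (subfield_of_order (q ^ d)) a = 1"
proof -
  obtain t where n_eq: "n = t * d" using assms(2) by (metis dvdE mult.commute)
  have "t * d \<le> (d - 1) * d" using assms(1) n_eq by (simp add: mult.commute)
  then have "t \<le> d - 1" using d by simp
  then have t: "0 < t" "t < d" using d n n_eq by auto
  have "gcd d n = d" using assms(2) by (simp add: gcd_proj1_if_dvd)
  then have norm: "field_norm (subfield_of_order (q ^ d)) a = (\<Prod>i<t. (\<sigma> ^^ (i * d)) a)"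
    using norm_eq_prod[of a] d n_eq by simp
  let ?A = "\<lambda>k. (\<sigma> ^^ k) a" and ?B = "\<lambda>k. (\<sigma> ^^ k) b"
  have z: "linrec d ?A ?B w n = (\<Sum>v\<le>t. walk_sum d ?A ?B t 0 v * w v)" for w
    unfolding n_eq using d t by (intro linrec_multiple) auto
  have delta: "linrec d ?A ?B (\<lambda>i. of_bool (i = v)) n = walk_sum d ?A ?B t 0 v" if "v \<le> t" for v
  proof -
    have "(\<Sum>u\<le>t. walk_sum d ?A ?B t 0 u * of_bool (u = v)) =
        (\<Sum>u\<le>t. if u = v then walk_sum d ?A ?B t 0 u else 0)"
      by (intro sum.cong) auto
    then show ?thesis using that unfolding z by simp
  qed
  show ?thesis
  proof
    assume "subspace_dim \<iota> (ker (L_map \<sigma> d a b)) = d"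
    note w = this[unfolded dim_ker_L_map_eq_iff, rule_format]
    have "walk_sum d ?A ?B t 0 t = 0"
      using delta[of t] w[of "\<lambda>i. of_bool (i = t)"] t by simp
    then have "b = 0" unfolding walk_sum_full by (auto simp: iter_eq_0_iff)
    moreover have "walk_sum d ?A ?B t 0 0 = 1"
      using delta[of 0] w[of "\<lambda>i. of_bool (i = 0)"] by simp
    then have "field_norm (subfield_of_order (q ^ d)) a = 1" by (simp add: norm walk_sum_0)
    ultimately show "b = 0 \<and> field_norm (subfield_of_order (q ^ d)) a = 1" ..
  next
    assume *: "b = 0 \<and> field_norm (subfield_of_order (q ^ d)) a = 1"
    have "linrec d ?A ?B w n = w 0" for w
    proof -
      have "linrec d ?A ?B w n = (\<Sum>v\<in>{0}. walk_sum d ?A ?B t 0 v * w v)"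
        unfolding z using * walk_sum_no_B[of _ d ?A t 0]
        by (intro sum.mono_neutral_right) (auto simp: zero)
      then show ?thesis using * by (simp add: norm walk_sum_0)
    qed
    then show "subspace_dim \<iota> (ker (L_map \<sigma> d a b)) = d" by (simp add: dim_ker_L_map_eq_iff)
  qed
qed

lemma dim_ker_extremal:
  assumes n_eq: "n = d * (d - 1) + 1"
  shows "subspace_dim \<iota> (ker (L_map \<sigma> d a b)) = d \<longleftrightarrow>
    field_norm (subfield_of_order q) a = (-1) ^ (d - 1) \<and> b = - pow_sigma_f1 \<sigma> d a \<and>
    (\<exists>k. d - 1 = CHAR('k) ^ k)"
proof -
  define A B where "A = (\<lambda>k. (\<sigma> ^^ k) a)" and "B = (\<lambda>k. (\<sigma> ^^ k) b)"
  define T where "T = walk_sum d A B (d - 1) 1"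
  define f where "f = pow_sigma_f1 \<sigma> d a"
  define N where "N = field_norm (subfield_of_order q) a"
  obtain e where d_eq: "d = Suc e" using d by (cases d) auto
  have iff: "subspace_dim \<iota> (ker (L_map \<sigma> d a b)) = d \<longleftrightarrow> T (d - 1) * a = 1 \<and>
      T 0 + T (d - 1) * b = 0 \<and> (\<forall>v. 0 < v \<and> v < d - 1 \<longrightarrow> T v = 0)"
    unfolding dim_ker_L_map_eq_iff n_eq linrec_periodic_iff[OF d] by (simp add: T_def A_def B_def)
  have per: "A (k + n) = A k" for k
    using \<sigma>_period[of a] by (simp add: A_def funpow_add)
  have f: "f = a * T 0"
  proof -
    have "f = (\<Prod>i<Suc e. A (i * d + 1))" by (simp only: f_def pow_sigma_f1_def A_def d_eq)
    also have "\<dots> = (\<Prod>i<e. A (i * d + 1)) * A (e * d + 1)" by (rule prod.lessThan_Suc)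
    \<comment> \<open>Here \<open>e * d + 1 = n\<close>, so the last factor of \<open>f\<close> is
      \<open>a\<close> itself.\<close>
    also have "A (e * d + 1) = a" using per[of 0] n_eq by (simp add: d_eq A_def mult.commute)
    finally show ?thesis by (simp add: T_def walk_sum_0 d_eq mult.commute)
  qed
  have "gcd d n = 1"
    unfolding n_eq mult.commute[of d] gcd_add_mult by simp
  then have N: "N = (\<Prod>i<n. A (i * d))" using norm_eq_prod[of a] by (simp add: N_def A_def)
  have gauge: "T v = (-1) ^ v * of_nat (d - 1 choose v) * (\<Prod>i<d - 1 - v + d * v. A (1 + v + i * d))"
    if b: "b = - f" and "v \<le> d - 1" for v
    unfolding T_def
  proof (rule walk_sum_gauge[where A = A and n = n])
    show "n + d = d * d + 1" by (simp add: n_eq d_eq)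
    show "A (k + n) = A k" for k by (rule per)
    show "v \<le> d - 1" by fact
    fix k
    have "B k = - (\<Prod>i<d. (\<sigma> ^^ k) ((\<sigma> ^^ (i * d + 1)) a))"
      unfolding B_def b f_def pow_sigma_f1_def minus iter_prod ..
    moreover have "(\<sigma> ^^ k) ((\<sigma> ^^ (i * d + 1)) a) = A (i * d + 1 + k)" for i
      by (metis A_def add.commute comp_apply funpow_add)
    ultimately show "B k = - (\<Prod>i<d. A (i * d + 1 + k))" by (simp only:)
  qed
  \<comment> \<open>The progression in \<open>T (d - 1)\<close> runs over the multiples of
    \<open>d\<close> from \<open>d\<close> to \<open>d * (n - 1)\<close>; the factor
    \<open>a\<close> supplies the multiple 0 and completes the norm.\<close>
  have T_last: "T (d - 1) * a = (-1) ^ (d - 1) * N" if "b = - f"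
  proof -
    have "T (d - 1) * a = (-1) ^ (d - 1) * ((\<Prod>i<d * (d - 1). A (Suc i * d)) * A (0 * d))"
    proof -
      have "1 + (d - 1) + i * d = Suc i * d" for i using d by simp
      moreover have "d - 1 - (d - 1) + d * (d - 1) = d * (d - 1)" by simp
      ultimately have "T (d - 1) = (-1) ^ (d - 1) * (\<Prod>i<d * (d - 1). A (Suc i * d))"
        using gauge[OF that order_refl] by (simp only: binomial_n_n of_nat_1 mult_1_right)
      moreover have "A (0 * d) = a" by (simp add: A_def)
      ultimately show ?thesis by (simp only: mult.assoc)
    qed
    also have "(\<Prod>i<d * (d - 1). A (Suc i * d)) * A (0 * d) = N"
      unfolding N n_eq add_0_right Suc_eq_plus1[symmetric] prod.lessThan_Suc_shift by (rule mult.commute)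
    finally show ?thesis .
  qed
  have sign: "(-1) ^ (d - 1) * N = 1 \<longleftrightarrow> N = (-1) ^ (d - 1)"
  proof -
    define u :: 'a where "u = (-1) ^ (d - 1)"
    have u: "u * u = 1" unfolding u_def power_mult_distrib[symmetric] by simp
    have "u * N = 1 \<longleftrightarrow> N = u"
    proof
      assume uN: "u * N = 1"
      have "u * (u * N) = N" by (simp only: mult.assoc[symmetric] u mult_1_left)
      then show "N = u" unfolding uN by simp
    qed (simp only: u)
    then show ?thesis unfolding u_def .
  qed
  have char: "(of_nat m :: 'a) = 0 \<longleftrightarrow> CHAR('k) dvd m" for m
    unfolding CHAR_eq_if_CARD_power[OF card_k card_a q n] by (rule of_nat_eq_0_iff_char_dvd)
  have p: "prime CHAR('k)"
    using prime_power_CHAR(2)[of q 1, where ?'a='k] card_k q by simp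
  have T_mid: "T v = 0 \<longleftrightarrow> CHAR('k) dvd (d - 1 choose v)"
    if "b = - f" "a \<noteq> 0" "v < d - 1" for v
  proof -
    have "A k \<noteq> 0" for k using \<open>a \<noteq> 0\<close> unfolding A_def iter_eq_0_iff .
    moreover have "v \<le> d - 1" using \<open>v < d - 1\<close> by simp
    ultimately show ?thesis unfolding gauge[OF \<open>b = - f\<close> \<open>v \<le> d - 1\<close>] by (simp add: char)
  qed
  \<comment> \<open>Multiplying the second condition by \<open>a\<close> and inserting the first
    leaves \<open>a * T 0 + b = 0\<close>, where \<open>a * T 0\<close> is \<open>f\<close>.\<close>
  have b: "b = - f" if "T (d - 1) * a = 1" "T 0 + T (d - 1) * b = 0"
  proof -
    have "a * T 0 + (T (d - 1) * a) * b = a * (T 0 + T (d - 1) * b)" by (simp add: algebra_simps)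
    then show ?thesis using that by (simp add: f eq_neg_iff_add_eq_0 add.commute)
  qed
  show ?thesis unfolding iff N_def[symmetric] f_def[symmetric]
  proof (intro iffI conjI; (elim conjE)?)
    assume *: "T (d - 1) * a = 1" "T 0 + T (d - 1) * b = 0"
      "\<forall>v. 0 < v \<and> v < d - 1 \<longrightarrow> T v = 0"
    show "b = - f" by (rule b[OF *(1,2)])
    then show "N = (-1) ^ (d - 1)" using T_last *(1) sign by simp
    have "a \<noteq> 0" using *(1) by auto
    show "\<exists>k. d - 1 = CHAR('k) ^ k"
      using T_mid[OF \<open>b = - f\<close> \<open>a \<noteq> 0\<close>] *(3) d
      by (intro eq_prime_power_if_dvd_choose[OF p]) auto
  next
    assume *: "N = (-1) ^ (d - 1)" "b = - f" "\<exists>k. d - 1 = CHAR('k) ^ k"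
    show last: "T (d - 1) * a = 1" using T_last[OF *(2)] sign *(1) by simp
    have "T 0 + T (d - 1) * b = T 0 - (T (d - 1) * a) * T 0"
      by (simp add: *(2) f mult.assoc)
    then show "T 0 + T (d - 1) * b = 0" by (simp only: last mult_1_left diff_self)
    have "a \<noteq> 0" using last by auto
    obtain k where k: "d - 1 = CHAR('k) ^ k" using *(3) ..
    show "\<forall>v. 0 < v \<and> v < d - 1 \<longrightarrow> T v = 0"
    proof (intro allI impI, elim conjE)
      fix v assume v: "0 < v" "v < d - 1"
      then show "T v = 0"
        using T_mid[OF *(2) \<open>a \<noteq> 0\<close> v(2)] prime_dvd_choose_prime_power[OF p, of v k]
        unfolding k by simp
    qed
  qed
qed

end

theorem theorem1p3:
  fixes q d n s :: nat
    and \<iota> :: "'k::{field,finite} \<Rightarrow> 'a::{field,finite}"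
    and \<sigma> :: "'a \<Rightarrow> 'a"
  assumes "primepow q"
    and "CARD('k) = q"
    and "CARD('a) = q ^ n"
    and "field_embedding \<iota>"
    and "n > 0" and "s > 0" and "d \<ge> 3"
    and "gcd s n = 1"
    and "\<sigma> = frob q s"
  shows "(n \<le> d * (d - 1) \<and> \<not> d dvd n \<longrightarrow>
            (\<forall>a b. subspace_dim \<iota> (ker (L_map \<sigma> d a b)) < d))
       \<and> (n \<le> d * (d - 1) \<and> d dvd n \<longrightarrow>
            (\<forall>a b. subspace_dim \<iota> (ker (L_map \<sigma> d a b)) = d \<longleftrightarrow>
               b = 0 \<and> field_norm (subfield_of_order (q ^ d)) a = 1))
       \<and> (n = d * (d - 1) + 1 \<longrightarrow>
            (\<forall>a b. subspace_dim \<iota> (ker (L_map \<sigma> d a b)) = d \<longleftrightarrow>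
               field_norm (subfield_of_order q) a = (-1) ^ (d - 1) \<and>
               b = - pow_sigma_f1 \<sigma> d a \<and>
               (\<exists>k. d - 1 = CHAR('k) ^ k)))"
proof (intro conjI impI allI; (elim conjE)?)
  fix a b
  show "subspace_dim \<iota> (ker (L_map \<sigma> d a b)) < d"
    if "n \<le> d * (d - 1)" "\<not> d dvd n"
    by (rule dim_ker_not_dvd[OF assms that])
  show "subspace_dim \<iota> (ker (L_map \<sigma> d a b)) = d \<longleftrightarrow>
      b = 0 \<and> field_norm (subfield_of_order (q ^ d)) a = 1"
    if "n \<le> d * (d - 1)" "d dvd n"
    by (rule dim_ker_dvd[OF assms that])
  show "subspace_dim \<iota> (ker (L_map \<sigma> d a b)) = d \<longleftrightarrow>
      field_norm (subfield_of_order q) a = (-1) ^ (d - 1) \<and>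
      b = - pow_sigma_f1 \<sigma> d a \<and> (\<exists>k. d - 1 = CHAR('k) ^ k)"
    if "n = d * (d - 1) + 1"
    by (rule dim_ker_extremal[OF assms that])
qed

end
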